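(* Let $R$ be an integral domain and let $A$ be an $n\times n$ acyclic matrix with entries in $R$. Then for any positive integer $k$, any $k$ positive integers $m_1,m_2,\ldots,m_k$, and any sequence of integers $i_1,i_2,\ldots,i_k$ with $1\le i_t\le n$ for every $t$, we have $$(A^{m_1})_{i_1i_2}(A^{m_2})_{i_2i_3}\cdots (A^{m_k})_{i_ki_1} = (A^{m_1})_{i_2i_1}(A^{m_2})_{i_3i_2}\cdots (A^{m_k})_{i_1i_k}.$$ (That is, with $i_{k+1}:=i_1$, $\prod_{t=1}^k (A^{m_t})_{i_t i_{t+1}}=\prod_{t=1}^k (A^{m_t})_{i_{t+1} i_t}$.)
   Context: $B_{ij}$ (also written $B_{i,j}$) denotes the $(i,j)$-th entry of a matrix $B$. To an $n\times n$ matrix $A$ one associates the digraph $D(A)$ with vertex set $\{1,2,\ldots,n\}$, in which there is a directed edge $(i,j)$ from $i$ to $j$ if and only if $A_{i,j}\neq 0$ (loops are allowed); the edge $(i,j)$ carries the weight $A_{i,j}$. The matrix $A$ is called acyclic if $D(A)$ contains no directed cycle of length $\ge 3$, i.e. there are no $r\geq 3$ pairwise distinct vertices $v_1,\ldots,v_r$ such that $(v_1,v_2),(v_2,v_3),\ldots,(v_{r-1},v_r),(v_r,v_1)$ are all directed edges of $D(A)$. Loops and directed cycles of length $2$ are permitted. *)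

theory Defs
  imports "Jordan_Normal_Form.Matrix" "Graph_Theory.Graph_Theory"
begin

text \<open>
  Rows and columns of a \<^typ>\<open>'a mat\<close> are numbered from \<open>0\<close>, so the vertices
  \<open>1, \<dots>, n\<close> of the informal definition become \<open>0, \<dots>, n - 1\<close>.
\<close>

definition mat_digraph :: "'a::zero mat \<Rightarrow> nat pair_pre_digraph" where
  "mat_digraph A =
    \<lparr> pverts = {..<dim_row A},
      parcs = {(i, j). i < dim_row A \<and> j < dim_col A \<and> A $$ (i, j) \<noteq> 0} \<rparr>"

definition acyclic_mat :: "'a::zero mat \<Rightarrow> bool" where
  "acyclic_mat A \<longleftrightarrow>
    \<not> (\<exists>vs. length vs \<ge> 3 \<and> distinct vs \<and> set vs \<subseteq> pverts (mat_digraph A) \<and>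
          (\<forall>t < length vs. (vs ! t, vs ! (Suc t mod length vs)) \<in> parcs (mat_digraph A)))"

end

theory Submission
  imports Defs
begin

text \<open>
  For a closed walk in the complete digraph, the product of the edge weights does not change when
  every edge is reversed: a closed walk with a repeated vertex splits into two shorter closed
  walks, and one on at least three distinct vertices has weight zero in both directions, since
  neither it nor its reversal is a cycle of the digraph of an acyclic matrix. Expanding each power
  of the matrix as a sum over walks reduces the general identity to this one.
\<close>

text \<open>A walk is its start \<open>u\<close> together with the list \<open>vs\<close> of later
  vertices; it is closed when \<open>last (u # vs) = u\<close>, and \<open>vs\<close> then omits the
  duplicate of the base point.\<close>

fun walk_weight :: "('v \<Rightarrow> 'v \<Rightarrow> 'a::comm_monoid_mult) \<Rightarrow> 'v \<Rightarrow> 'v list \<Rightarrow> 'a" where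
  "walk_weight f u [] = 1"
| "walk_weight f u (v # vs) = f u v * walk_weight f v vs"

lemma walk_weight_append:
  "walk_weight f u (xs @ ys) = walk_weight f u xs * walk_weight f (last (u # xs)) ys"
  by (induction xs arbitrary: u) (auto simp: mult.assoc)

lemma walk_weight_conv_prod:
  "walk_weight f u vs = (\<Prod>t<length vs. f ((u # vs) ! t) (vs ! t))"
  by (induction vs arbitrary: u) (auto simp: prod.lessThan_Suc_shift simp del: prod.lessThan_Suc)

text \<open>As \<open>u\<close> is the last entry of \<open>vs\<close>, the first edge of the walk
  is the wrap-around edge in the cyclic indexing used by \<open>acyclic_mat\<close>.\<close>

lemma closed_walk_weight_conv_prod:
  assumes "vs \<noteq> []" and "last vs = u"
  shows "walk_weight f u vs = (\<Prod>t<length vs. f (vs ! t) (vs ! (Suc t mod length vs)))"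
proof -
  obtain l where l: "length vs = Suc l"
    using assms(1) by (cases vs) auto
  have "walk_weight f u vs = f (vs ! l) (vs ! 0) * (\<Prod>t<l. f (vs ! t) (vs ! Suc t))"
    using assms l unfolding walk_weight_conv_prod
    by (simp add: prod.lessThan_Suc_shift last_conv_nth del: prod.lessThan_Suc)
  also have "(\<Prod>t<l. f (vs ! t) (vs ! Suc t))
      = (\<Prod>t<l. f (vs ! t) (vs ! (Suc t mod length vs)))"
    using l by (intro prod.cong) auto
  finally show ?thesis
    using l by (simp add: mult.commute)
qed

lemma acyclic_mat_closed_walk_reverse:
  fixes A :: "'a::comm_semiring_1 mat"
  assumes A: "A \<in> carrier_mat n n" and acyclic: "acyclic_mat A"
    and "set vs \<subseteq> {..<n}" and "last (u # vs) = u"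
  shows "walk_weight (\<lambda>x y. A $$ (x, y)) u vs = walk_weight (\<lambda>x y. A $$ (y, x)) u vs"
  using assms(3,4)
proof (induction vs arbitrary: u rule: length_induct)
  case (1 vs)
  show ?case
  proof (cases "distinct vs")
    case False
    then obtain xs y ys zs where vs: "vs = xs @ [y] @ ys @ [y] @ zs"
      using not_distinct_decomp by blast
    \<comment> \<open>Cutting out the loop \<open>ys @ [y]\<close> at \<open>y\<close> keeps the
      last entry even if \<open>zs\<close> is empty, so the remaining walk is still closed at
      \<open>u\<close>.\<close>
    have "walk_weight (\<lambda>x y. A $$ (x, y)) u (xs @ [y] @ zs)
        = walk_weight (\<lambda>x y. A $$ (y, x)) u (xs @ [y] @ zs)"
      using 1 by (auto simp: vs)
    moreover have "walk_weight (\<lambda>x y. A $$ (x, y)) y (ys @ [y])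
        = walk_weight (\<lambda>x y. A $$ (y, x)) y (ys @ [y])"
      using 1 by (auto simp: vs)
    moreover have "walk_weight f u vs
        = walk_weight f u (xs @ [y] @ zs) * walk_weight f y (ys @ [y])" for f :: "nat \<Rightarrow> nat \<Rightarrow> 'a"
      by (simp add: vs walk_weight_append mult_ac)
    ultimately show ?thesis
      by simp
  next
    case True
    \<comment> \<open>Reversal at most swaps two commuting factors in the first three cases; only
      the last one needs acyclicity.\<close>
    consider "vs = []" | v where "vs = [v]" | v w where "vs = [v, w]" | "length vs \<ge> 3"
      by (cases vs rule: remdups_adj.cases; cases "tl (tl vs)") auto
    then show ?thesis
    proof cases
      case 4
      let ?l = "length vs"
      have "vs \<noteq> []"
        using 4 by auto
      then have closed: "vs \<noteq> []" "last vs = u"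
        using "1.prems" by auto
      have bound: "vs ! t < n" if "t < ?l" for t
        using that "1.prems" nth_mem by blast
      have bound': "vs ! (t mod ?l) < n" for t
        using closed by (intro bound) simp
      have "\<exists>t<?l. A $$ (vs ! t, vs ! (Suc t mod ?l)) = 0"
        using acyclic 4 True "1.prems"(1) A bound bound'
        unfolding acyclic_mat_def mat_digraph_def by auto
      moreover have "\<exists>t<?l. A $$ (vs ! (Suc t mod ?l), vs ! t) = 0"
      proof -
        have "\<not> (\<forall>t<?l. A $$ (rev vs ! t, rev vs ! (Suc t mod ?l)) \<noteq> 0)"
        proof
          assume *: "\<forall>t<?l. A $$ (rev vs ! t, rev vs ! (Suc t mod ?l)) \<noteq> 0"
          have "rev vs ! t < n" if "t < ?l" for t
            using that "1.prems" nth_mem[of t "rev vs"] by auto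
          then have "\<exists>vs. length vs \<ge> 3 \<and> distinct vs \<and> set vs \<subseteq> pverts (mat_digraph A) \<and>
            (\<forall>t < length vs. (vs ! t, vs ! (Suc t mod length vs)) \<in> parcs (mat_digraph A))"
            using * 4 True "1.prems"(1) A closed
            by (intro exI[of _ "rev vs"]) (auto simp: mat_digraph_def)
          then show False
            using acyclic unfolding acyclic_mat_def by blast
        qed
        then obtain t where t: "t < ?l" "A $$ (rev vs ! t, rev vs ! (Suc t mod ?l)) = 0"
          by blast
        show ?thesis
        \<comment> \<open>Edge \<open>t\<close> of \<open>rev vs\<close> reverses edge
          \<open>?l - Suc (Suc t)\<close> of \<open>vs\<close>, except that the two wrap-around
          edges, both of index \<open>?l - 1\<close>, reverse each other.\<close>
        proof (cases "Suc t < ?l")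
          case True
          then have "Suc (?l - Suc (Suc t)) = ?l - Suc t" by simp
          then show ?thesis
            using t True by (intro exI[of _ "?l - Suc (Suc t)"]) (simp add: rev_nth)
        next
          case False
          then have "?l = Suc t" using t by simp
          then show ?thesis
            using t by (intro exI[of _ t]) (simp add: rev_nth)
        qed
      qed
      ultimately show ?thesis
        unfolding closed_walk_weight_conv_prod[OF closed] by (simp add: prod_zero Bex_def)
    qed (use 1 in \<open>auto simp: mult.commute\<close>)
  qed
qed

text \<open>A forward walk is extended by the first edge of the power, whereas
  \<open>pow_mat\<close> splits off the last factor, which suits the reversed walk.\<close>

lemma pow_mat_Suc_left:
  assumes "A \<in> carrier_mat n n"
  shows "A ^\<^sub>m Suc m = A * A ^\<^sub>m m"
proof (induction m)
  case (Suc m)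
  then show ?case
    using assms by (metis assoc_mult_mat pow_carrier_mat pow_mat.simps(2))
qed (use assms in auto)

text \<open>Here \<open>a\<close> and \<open>b\<close> stand for the factors not yet expanded.
  Induction on \<open>m\<close> moves one edge at a time from the power into the walk
  \<open>vs\<close>, until the walk ends at \<open>w\<close> and \<open>walks\<close>
  applies.\<close>

lemma walk_weight_mult_pow_mat:
  fixes A :: "'a::comm_semiring_1 mat"
  assumes A: "A \<in> carrier_mat n n"
    and walks: "\<And>vs. set vs \<subseteq> {..<n} \<Longrightarrow> last (u # vs) = w \<Longrightarrow>
      walk_weight (\<lambda>x y. A $$ (x, y)) u vs * a = walk_weight (\<lambda>x y. A $$ (y, x)) u vs * b"
    and "w < n" and "last (u # vs) = v" and "v < n" and "set vs \<subseteq> {..<n}"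
  shows "walk_weight (\<lambda>x y. A $$ (x, y)) u vs * ((A ^\<^sub>m m) $$ (v, w) * a) =
         walk_weight (\<lambda>x y. A $$ (y, x)) u vs * ((A ^\<^sub>m m) $$ (w, v) * b)"
  using assms(4-6)
proof (induction m arbitrary: v vs)
  case 0
  then show ?case
    using walks[of vs] A \<open>w < n\<close> by (cases "v = w") auto
next
  case (Suc m)
  have Am: "A ^\<^sub>m m \<in> carrier_mat n n"
    using A by simp
  let ?W = "walk_weight (\<lambda>x y. A $$ (x, y)) u" and ?W' = "walk_weight (\<lambda>x y. A $$ (y, x)) u"
  have "(A ^\<^sub>m Suc m) $$ (v, w) = (\<Sum>l<n. A $$ (v, l) * (A ^\<^sub>m m) $$ (l, w))"
    using A Am Suc.prems \<open>w < n\<close>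
    by (simp add: pow_mat_Suc_left[OF A] scalar_prod_def lessThan_atLeast0 del: pow_mat.simps)
  then have "?W vs * ((A ^\<^sub>m Suc m) $$ (v, w) * a)
      = (\<Sum>l<n. ?W (vs @ [l]) * ((A ^\<^sub>m m) $$ (l, w) * a))"
    using Suc.prems
    by (simp add: walk_weight_append sum_distrib_left sum_distrib_right mult.assoc del: pow_mat.simps)
  also have "\<dots> = (\<Sum>l<n. ?W' (vs @ [l]) * ((A ^\<^sub>m m) $$ (w, l) * b))"
    using Suc.prems by (intro sum.cong refl Suc.IH) auto
  also have "\<dots> = ?W' vs * ((\<Sum>l<n. (A ^\<^sub>m m) $$ (w, l) * A $$ (l, v)) * b)"
    using Suc.prems by (simp add: walk_weight_append sum_distrib_left sum_distrib_right mult_ac)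
  also have "(\<Sum>l<n. (A ^\<^sub>m m) $$ (w, l) * A $$ (l, v)) = (A ^\<^sub>m Suc m) $$ (w, v)"
    using A Am Suc.prems \<open>w < n\<close> by (simp add: scalar_prod_def lessThan_atLeast0)
  finally show ?case .
qed

theorem theorem1p2:
  fixes A :: "'a::idom mat" and n k :: nat and m i :: "nat \<Rightarrow> nat"
  assumes "A \<in> carrier_mat n n"
    and "acyclic_mat A"
    and "k > 0"
    and "\<And>t. t < k \<Longrightarrow> m t > 0"
    and "\<And>t. t < k \<Longrightarrow> i t < n"
  shows "(\<Prod>t<k. (A ^\<^sub>m m t) $$ (i t, i (Suc t mod k))) =
         (\<Prod>t<k. (A ^\<^sub>m m t) $$ (i (Suc t mod k), i t))"
proof -
  have bound: "i (t mod k) < n" for t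
    using assms(3,5) by simp
  \<comment> \<open>Generalised for the induction: the powers before index \<open>s\<close> have
    been replaced by one walk \<open>vs\<close> from \<open>i 0\<close> to
    \<open>i (s mod k)\<close>. The induction descends from \<open>s = k\<close>, where the products
    are empty and \<open>k mod k = 0\<close> makes the walk closed.\<close>
  have "walk_weight (\<lambda>x y. A $$ (x, y)) (i 0) vs *
          (\<Prod>t=s..<k. (A ^\<^sub>m m t) $$ (i t, i (Suc t mod k))) =
        walk_weight (\<lambda>x y. A $$ (y, x)) (i 0) vs *
          (\<Prod>t=s..<k. (A ^\<^sub>m m t) $$ (i (Suc t mod k), i t))"
    if "s \<le> k" "set vs \<subseteq> {..<n}" "last (i 0 # vs) = i (s mod k)" for s vs
    using that
  proof (induction s arbitrary: vs rule: inc_induct)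
    case base
    then show ?case
      using acyclic_mat_closed_walk_reverse[OF assms(1,2), of vs "i 0"] by simp
  next
    case (step s)
    show ?case
      \<comment> \<open>The claim for \<open>Suc s\<close> serves as \<open>walks\<close>, with the
        products over the later indices as \<open>a\<close> and \<open>b\<close>.\<close>
      using walk_weight_mult_pow_mat[OF assms(1) step.IH bound step.prems(2) bound step.prems(1)]
        step.hyps
      by (simp add: prod.atLeast_Suc_lessThan)
  qed
  from this[of 0 "[]"] show ?thesis
    by (simp add: lessThan_atLeast0)
qed

end
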